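(* Let $n\in\mathbb{N}$ and $k\in\mathbb{R}$. Then $\mathcal{D}_{k,n}(\mathbb{R})\subseteq\mathcal{S}_{k,n}(\mathbb{R})$ and the embedding $\mathcal{D}_{k,n}(\mathbb{R})\hookrightarrow\mathcal{S}_{k,n}(\mathbb{R})$ is continuous.
   Context: $\mathbb{N}=\{1,2,3,\dots\}$, $\mathbb{N}_0=\mathbb{N}\cup\{0\}$. The one-dimensional Dunkl Laplacian acts on functions on $\mathbb{R}\setminus\{0\}$ by $$(\Delta_k f)(x)=f''(x)+\frac{2k}{x}f'(x)-k\,\frac{f(x)-f(-x)}{x^2},\qquad x\in\mathbb{R}\setminus\{0\}.$$ $|x|^{2-\frac2n}\Delta_k$ denotes the operator $f\mapsto |x|^{2-\frac2n}(\Delta_kf)(x)$, and $\bigl(|x|^{2-\frac2n}\Delta_k\bigr)^\beta$ its $\beta$-fold iterate. $\mathcal{S}_{k,n}(\mathbb{R})$ is the space of all $f\in C^\infty(\mathbb{R}\setminus\{0\})$ such that $$\sup_{x\in\mathbb{R}\setminus\{0\}}\left|\bigl(|x|^{\frac2n}\bigr)^{\alpha}\bigl(|x|^{2-\frac2n}\Delta_k\bigr)^{\beta}\bigl(x^\ell f^{(\ell)}(x)\bigr)\right|<\infty\quad\text{for all }\alpha,\beta,\ell\in\mathbb{N}_0 .$$ $\mathcal{D}_{k,n}(\mathbb{R})$ is the space of all $f\in C^\infty(\mathbb{R}\setminus\{0\})$ with bounded support such that $$\sup_{x\in\mathbb{R}\setminus\{0\}}\left|\bigl(|x|^{2-\frac2n}\Delta_k\bigr)^{\beta}\bigl(x^\ell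 f^{(\ell)}(x)\bigr)\right|<\infty\quad\text{for all }\beta,\ell\in\mathbb{N}_0 .$$ Topology: set $P_{\alpha,\beta}(g)=\sup_{x\in\mathbb{R}\setminus\{0\}}\bigl|\bigl(n|x|^{\frac2n}\bigr)^\alpha\bigl(n|x|^{2-\frac2n}\Delta_k\bigr)^\beta g(x)\bigr|$. The topology of both spaces is the one determined by the seminorms $f\mapsto P_{\alpha,\beta}\bigl(x^\ell f^{(\ell)}\bigr)$, $\alpha,\beta,\ell\in\mathbb{N}_0$; equivalently by the seminorms $f\mapsto P_{\alpha,\beta}(f_m)$, $\alpha,\beta,m\in\mathbb{N}_0$, where $f_m=\bigl(nx\frac{d}{dx}+(kn+1-\frac n2)I\bigr)^m f$. *)

theory Defs
  imports "HOL-Analysis.Analysis"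
begin

text \<open>
  A function on the punctured line is represented by a total function of type
  \<open>real \<Rightarrow> complex\<close> with the value 0 at the origin, so that the representation is unique.
  The operators below are only meaningful at nonzero points. There their values depend only on
  the argument function off the origin, so the value 0 and the division by 0 at the origin are
  harmless.
\<close>

definition vderiv :: "(real \<Rightarrow> complex) \<Rightarrow> real \<Rightarrow> complex" where
  "vderiv f = (\<lambda>x. vector_derivative f (at x))"

definition smooth_punctured :: "(real \<Rightarrow> complex) set" where
  "smooth_punctured =
     {f. f 0 = 0 \<and> (\<forall>m. \<forall>x\<in>-{0}. (vderiv ^^ m) f differentiable (at x))}"

definition dunkl_laplacian :: "real \<Rightarrow> (real \<Rightarrow> complex) \<Rightarrow> real \<Rightarrow> complex" where
  "dunkl_laplacian k f = (\<lambda>x.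
     (vderiv ^^ 2) f x + (2 * k / x) *\<^sub>R vderiv f x - (k / x\<^sup>2) *\<^sub>R (f x - f (- x)))"

definition weighted_dunkl :: "real \<Rightarrow> nat \<Rightarrow> (real \<Rightarrow> complex) \<Rightarrow> real \<Rightarrow> complex" where
  "weighted_dunkl k n f = (\<lambda>x. (\<bar>x\<bar> powr (2 - 2 / real n)) *\<^sub>R dunkl_laplacian k f x)"

definition euler_deriv :: "nat \<Rightarrow> (real \<Rightarrow> complex) \<Rightarrow> real \<Rightarrow> complex" where
  "euler_deriv l f = (\<lambda>x. (x ^ l) *\<^sub>R (vderiv ^^ l) f x)"

definition S_space :: "real \<Rightarrow> nat \<Rightarrow> (real \<Rightarrow> complex) set" where
  "S_space k n = {f \<in> smooth_punctured. \<forall>\<alpha> \<beta> l.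
     (SUP x\<in>-{0}. ennreal (norm
        ((\<bar>x\<bar> powr (2 / real n)) ^ \<alpha> *\<^sub>R (weighted_dunkl k n ^^ \<beta>) (euler_deriv l f) x))) < \<infinity>}"

definition D_space :: "real \<Rightarrow> nat \<Rightarrow> (real \<Rightarrow> complex) set" where
  "D_space k n = {f \<in> smooth_punctured. bounded {x. f x \<noteq> 0} \<and> (\<forall>\<beta> l.
     (SUP x\<in>-{0}. ennreal (norm ((weighted_dunkl k n ^^ \<beta>) (euler_deriv l f) x))) < \<infinity>)}"

definition P_seminorm :: "real \<Rightarrow> nat \<Rightarrow> nat \<Rightarrow> nat \<Rightarrow> (real \<Rightarrow> complex) \<Rightarrow> ennreal" where
  "P_seminorm k n \<alpha> \<beta> g =
     (SUP x\<in>-{0}. ennreal (norm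
        ((real n * \<bar>x\<bar> powr (2 / real n)) ^ \<alpha> *\<^sub>R
           ((\<lambda>h x. real n *\<^sub>R weighted_dunkl k n h x) ^^ \<beta>) g x)))"

text \<open>
  The locally convex topology on \<open>V\<close> determined by a family of seminorms \<open>p i\<close>: the coarsest
  one in which all semiballs centred at points of \<open>V\<close> are open.
\<close>

definition seminorm_topology ::
  "(real \<Rightarrow> complex) set \<Rightarrow> ('i \<Rightarrow> (real \<Rightarrow> complex) \<Rightarrow> ennreal) \<Rightarrow> (real \<Rightarrow> complex) topology" where
  "seminorm_topology V p = topology_generated_by
     {{g \<in> V. p i (\<lambda>x. g x - f x) < ennreal \<epsilon>} | i f \<epsilon>. f \<in> V \<and> 0 < \<epsilon>}"

definition schwartz_seminorm ::
  "real \<Rightarrow> nat \<Rightarrow> nat \<times> nat \<times> nat \<Rightarrow> (real \<Rightarrow> complex) \<Rightarrow> ennreal" where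
  "schwartz_seminorm k n = (\<lambda>(\<alpha>, \<beta>, l) f. P_seminorm k n \<alpha> \<beta> (euler_deriv l f))"

definition S_topology :: "real \<Rightarrow> nat \<Rightarrow> (real \<Rightarrow> complex) topology" where
  "S_topology k n = seminorm_topology (S_space k n) (schwartz_seminorm k n)"

definition D_topology :: "real \<Rightarrow> nat \<Rightarrow> (real \<Rightarrow> complex) topology" where
  "D_topology k n = seminorm_topology (D_space k n) (schwartz_seminorm k n)"

end

theory Submission
  imports Defs
begin

text \<open>
  Both topologies come from the same family of seminorms, so continuity only needs the triangle
  inequality for \<open>P\<^sub>\<alpha>\<^sub>\<beta>\<close>, applied to a semiball whose centre may lie outside \<open>\<D>\<close>. The inclusion holds
  because the operators preserve vanishing outside a symmetric interval, and \<open>\<bar>x\<bar> powr (2 / n)\<close> is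
  bounded on such an interval.
\<close>

section \<open>Smooth functions on the punctured line\<close>

text \<open>Drops the condition \<open>f 0 = 0\<close> of \<open>smooth_punctured\<close>: nonzero
  constants violate it, and a derivative may have any value at the origin.\<close>

definition smooth_off_0 :: "(real \<Rightarrow> complex) \<Rightarrow> bool" where
  "smooth_off_0 f \<longleftrightarrow> (\<forall>m. \<forall>x\<in>-{0}. (vderiv ^^ m) f differentiable (at x))"

lemma smooth_off_0_differentiable: "smooth_off_0 f \<Longrightarrow> x \<noteq> 0 \<Longrightarrow> f differentiable at x"
  unfolding smooth_off_0_def by (metis ComplI funpow_0 singletonD)

lemma smooth_off_0_vderiv: "smooth_off_0 f \<Longrightarrow> smooth_off_0 (vderiv f)"
  unfolding smooth_off_0_def by (metis comp_apply funpow_Suc_right)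

lemma has_vderiv:
  assumes "f differentiable at x" shows "(f has_vector_derivative vderiv f x) (at x)"
  using assms by (simp add: vderiv_def vector_derivative_works)

lemma vderivI: "(f has_vector_derivative D) (at x) \<Longrightarrow> vderiv f x = D"
  by (simp add: vderiv_def vector_derivative_at)

lemma has_vector_derivative_cong_open:
  assumes "(f has_vector_derivative D) (at x)" "open S" "x \<in> S" "\<And>y. y \<in> S \<Longrightarrow> f y = g y"
  shows "(g has_vector_derivative D) (at x)"
  using has_vector_derivative_transform_within_open[OF assms(1-3)] assms(4) by metis

text \<open>\<open>vector_derivative\<close> chooses some D satisfying
  \<open>has_vector_derivative\<close>. Since f and g admit the same D, the choices agree even where
  no derivative exists, so locality of \<open>vderiv\<close> can be claimed for arbitrary
  functions.\<close>

lemma vderiv_cong_open: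
  assumes "open S" "x \<in> S" "\<And>y. y \<in> S \<Longrightarrow> f y = g y"
  shows "vderiv f x = vderiv g x"
proof -
  have "(f has_vector_derivative D) (at x) \<longleftrightarrow> (g has_vector_derivative D) (at x)" for D
    using has_vector_derivative_cong_open[of f D x S g]
      has_vector_derivative_cong_open[of g D x S f] assms by auto
  then show ?thesis by (simp add: vderiv_def vector_derivative_def)
qed

text \<open>On each open half-line |x| is x or -x, so the ordinary power rule applies. The factor
  \<open>sgn x\<close> merges the two cases and is itself a generator of the algebra below.\<close>

lemma abs_powr_has_vector_derivative:
  assumes "x \<noteq> (0::real)"
  shows "((\<lambda>x. complex_of_real (\<bar>x\<bar> powr a)) has_vector_derivative
    complex_of_real (a * sgn x) * complex_of_real (\<bar>x\<bar> powr (a - 1))) (at x)"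
proof -
  have "((\<lambda>x. \<bar>x\<bar> powr a) has_real_derivative (a * sgn x) * \<bar>x\<bar> powr (a - 1)) (at x)"
  proof (cases "x > 0")
    case True
    have "((\<lambda>x. x powr a) has_real_derivative a * x powr (a - 1)) (at x)"
      using True by (auto intro!: derivative_eq_intros)
    then have "((\<lambda>x. \<bar>x\<bar> powr a) has_real_derivative a * x powr (a - 1)) (at x)"
      by (rule has_field_derivative_transform_within_open[where S="{0<..}"]) (use True in auto)
    then show ?thesis using True by simp
  next
    case False
    then have neg: "x < 0" using assms by simp
    have "((\<lambda>x. (- x) powr a) has_real_derivative - (a * (- x) powr (a - 1))) (at x)"
      using neg by (auto intro!: derivative_eq_intros)
    then have "((\<lambda>x. \<bar>x\<bar> powr a) has_real_derivative - (a * (- x) powr (a - 1))) (at x)"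
      by (rule has_field_derivative_transform_within_open[where S="{..<0}"]) (use neg in auto)
    then show ?thesis using neg by simp
  qed
  from has_vector_derivative_of_real[OF this]
  show ?thesis by simp
qed

text \<open>
  The algebra generated by the smooth functions and the coefficients of the operators. It is closed
  under differentiation, so by induction on the order its members are smooth.
\<close>

inductive smooth_generated :: "(real \<Rightarrow> complex) \<Rightarrow> bool" where
  smooth: "smooth_off_0 f \<Longrightarrow> smooth_generated f"
| const: "smooth_generated (\<lambda>x. c)"
| sgn: "smooth_generated (\<lambda>x. complex_of_real (sgn x))"
| abs_powr: "smooth_generated (\<lambda>x. complex_of_real (\<bar>x\<bar> powr a))"
| add: "smooth_generated f \<Longrightarrow> smooth_generated g \<Longrightarrow> smooth_generated (\<lambda>x. f x + g x)"
| mult: "smooth_generated f \<Longrightarrow> smooth_generated g \<Longrightarrow> smooth_generated (\<lambda>x. f x * g x)"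
| reflect: "smooth_generated f \<Longrightarrow> smooth_generated (\<lambda>x. f (- x))"
| cong: "smooth_generated f \<Longrightarrow> (\<And>x. x \<noteq> 0 \<Longrightarrow> f x = g x) \<Longrightarrow> smooth_generated g"

text \<open>The derivative is known only off the origin; the constructor \<open>cong\<close> absorbs
  whatever value \<open>vderiv f\<close> takes at 0.\<close>

lemma smooth_generatedI_deriv:
  assumes "\<And>x. x \<noteq> 0 \<Longrightarrow> (f has_vector_derivative g x) (at x)" "smooth_generated g"
  shows "(\<forall>x. x \<noteq> 0 \<longrightarrow> f differentiable at x) \<and> smooth_generated (vderiv f)"
  using assms by (metis smooth_generated.cong differentiableI_vector vderivI)

text \<open>Differentiability is carried through the induction because the sum, product and chain
  rules need it for the constituents.\<close>

lemma smooth_generated_vderiv: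
  assumes "smooth_generated f"
  shows "(\<forall>x. x \<noteq> 0 \<longrightarrow> f differentiable at x) \<and> smooth_generated (vderiv f)"
  using assms
proof induction
  case (smooth f)
  then show ?case
    by (auto intro: smooth_generated.smooth smooth_off_0_vderiv smooth_off_0_differentiable)
next
  case (const c)
  show ?case
    by (rule smooth_generatedI_deriv[where g="\<lambda>x. 0"]) (auto intro: smooth_generated.const)
next
  case sgn
  show ?case
  proof (rule smooth_generatedI_deriv[where g="\<lambda>x. 0"])
    fix x :: real assume x: "x \<noteq> 0"
    \<comment> \<open>The sign is constant on the open half-line containing x.\<close>
    show "((\<lambda>x. complex_of_real (sgn x)) has_vector_derivative 0) (at x)"
      by (rule has_vector_derivative_cong_open[where f="\<lambda>_. complex_of_real (sgn x)"
            and S="if x > 0 then {0<..} else {..<0}"]) (use x in \<open>auto split: if_splits\<close>)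
  qed (rule smooth_generated.const)
next
  case (abs_powr a)
  have "smooth_generated (\<lambda>x. complex_of_real a * complex_of_real (sgn x) *
      complex_of_real (\<bar>x\<bar> powr (a - 1)))"
    by (intro smooth_generated.mult smooth_generated.const smooth_generated.sgn
        smooth_generated.abs_powr)
  then show ?case
    by (intro smooth_generatedI_deriv[OF abs_powr_has_vector_derivative]) simp_all
next
  case (add f g)
  then show ?case
    by (intro smooth_generatedI_deriv[where g="\<lambda>x. vderiv f x + vderiv g x"])
      (auto intro!: has_vector_derivative_add has_vderiv smooth_generated.add)
next
  case (mult f g)
  then show ?case
    by (intro smooth_generatedI_deriv[where g="\<lambda>x. f x * vderiv g x + vderiv f x * g x"])
      (auto intro!: has_vector_derivative_mult has_vderiv smooth_generated.add smooth_generated.mult)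
next
  case (reflect f)
  show ?case
  proof (rule smooth_generatedI_deriv[where g="\<lambda>x. - 1 * vderiv f (- x)"])
    fix x :: real assume "x \<noteq> 0"
    then have "(f has_vector_derivative vderiv f (- x)) (at (- x))"
      using reflect by (intro has_vderiv) auto
    from vector_diff_chain_at[of uminus "- 1" x f, OF _ this]
    show "((\<lambda>x. f (- x)) has_vector_derivative - 1 * vderiv f (- x)) (at x)"
      by (simp add: o_def has_vector_derivative_minus)
  qed (use reflect in \<open>intro smooth_generated.mult smooth_generated.const
         smooth_generated.reflect, auto\<close>)
next
  case (cong f g)
  show ?case
    by (rule smooth_generatedI_deriv[where g="vderiv f"])
      (use cong in \<open>auto intro: has_vector_derivative_cong_open[of f _ _ "-{0}"] has_vderiv\<close>)
qed

text \<open>All iterated derivatives of a generated function are generated, hence differentiable off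
  0. As a simp rule, the equivalence turns the constructors into closure properties of
  \<open>smooth_off_0\<close>.\<close>

lemma smooth_generated_iff [simp]: "smooth_generated f \<longleftrightarrow> smooth_off_0 f"
proof
  assume f: "smooth_generated f"
  have "smooth_generated ((vderiv ^^ m) f)" for m
    by (induction m) (use f smooth_generated_vderiv in auto)
  then show "smooth_off_0 f"
    using smooth_generated_vderiv unfolding smooth_off_0_def by blast
qed (rule smooth_generated.smooth)

lemmas smooth_off_0_const = smooth_generated.const[simplified]
  and smooth_off_0_abs_powr = smooth_generated.abs_powr[simplified]
  and smooth_off_0_sgn = smooth_generated.sgn[simplified]
  and smooth_off_0_add = smooth_generated.add[simplified]
  and smooth_off_0_mult = smooth_generated.mult[simplified]
  and smooth_off_0_reflect = smooth_generated.reflect[simplified]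
  and smooth_off_0_cong = smooth_generated.cong[simplified]

section \<open>Multiplication by the coefficients of the operators\<close>

lemma smooth_off_0_abs_powr_scale:
  assumes "smooth_off_0 f"
  shows "smooth_off_0 (\<lambda>x. (c * \<bar>x\<bar> powr a) *\<^sub>R f x)"
proof -
  have "smooth_off_0 (\<lambda>x. complex_of_real c * complex_of_real (\<bar>x\<bar> powr a) * f x)"
    by (intro smooth_off_0_mult smooth_off_0_const smooth_off_0_abs_powr assms)
  then show ?thesis by (simp add: scaleR_conv_of_real)
qed

lemma smooth_off_0_scaleR: "smooth_off_0 f \<Longrightarrow> smooth_off_0 (\<lambda>x. c *\<^sub>R f x)"
  by (simp add: scaleR_conv_of_real smooth_off_0_mult smooth_off_0_const)

lemma smooth_off_0_diff:
  assumes "smooth_off_0 f" "smooth_off_0 g"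
  shows "smooth_off_0 (\<lambda>x. f x - g x)"
  using smooth_off_0_add[OF assms(1) smooth_off_0_scaleR[OF assms(2), of "- 1"]] by simp

lemma smooth_off_0_sgn_scale: "smooth_off_0 f \<Longrightarrow> smooth_off_0 (\<lambda>x. sgn x *\<^sub>R f x)"
  using smooth_off_0_mult[OF smooth_off_0_sgn] by (simp only: scaleR_conv_of_real)

lemma smooth_off_0_power_scale:
  assumes "smooth_off_0 f"
  shows "smooth_off_0 (\<lambda>x. x ^ l *\<^sub>R f x)"
proof (induction l)
  case (Suc l)
  \<comment> \<open>Monomials are not among the generators, so one factor x is written as the
    product of its sign and |x|. The \<open>1 *\<close> fills the constant c of
    \<open>smooth_off_0_abs_powr_scale\<close>.\<close>
  have "smooth_off_0 (\<lambda>x. sgn x *\<^sub>R ((1 * \<bar>x\<bar> powr 1) *\<^sub>R (x ^ l *\<^sub>R f x)))"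
    by (intro smooth_off_0_sgn_scale smooth_off_0_abs_powr_scale Suc)
  then show ?case
  proof (rule smooth_off_0_cong)
    fix x :: real
    have "x ^ Suc l = sgn x * (\<bar>x\<bar> * x ^ l)"
      by (cases x "0::real" rule: linorder_cases) simp_all
    then show "sgn x *\<^sub>R ((1 * \<bar>x\<bar> powr 1) *\<^sub>R (x ^ l *\<^sub>R f x)) = x ^ Suc l *\<^sub>R f x"
      by (simp only: scaleR_scaleR mult_1) simp
  qed
qed (simp add: assms)

section \<open>Local additive operators\<close>

text \<open>
  Locality is stated for the complements of symmetric intervals only, since the Dunkl Laplacian
  also evaluates its argument at the reflected point.
\<close>

definition local_additive :: "((real \<Rightarrow> complex) \<Rightarrow> real \<Rightarrow> complex) \<Rightarrow> bool" where
  "local_additive T \<longleftrightarrow>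
     (\<forall>f. smooth_off_0 f \<longrightarrow> smooth_off_0 (T f)) \<and>
     (\<forall>f g. smooth_off_0 f \<longrightarrow> smooth_off_0 g \<longrightarrow>
        (\<forall>x. x \<noteq> 0 \<longrightarrow> T (\<lambda>x. f x + g x) x = T f x + T g x)) \<and>
     (\<forall>R f g. R \<ge> 0 \<longrightarrow> (\<forall>x. \<bar>x\<bar> > R \<longrightarrow> f x = g x) \<longrightarrow> (\<forall>x. \<bar>x\<bar> > R \<longrightarrow> T f x = T g x))"

lemma local_additive_smooth: "local_additive T \<Longrightarrow> smooth_off_0 f \<Longrightarrow> smooth_off_0 (T f)"
  by (simp add: local_additive_def)

lemma local_additive_add:
  "local_additive T \<Longrightarrow> smooth_off_0 f \<Longrightarrow> smooth_off_0 g \<Longrightarrow> x \<noteq> 0 \<Longrightarrow>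
    T (\<lambda>x. f x + g x) x = T f x + T g x"
  by (simp add: local_additive_def)

lemma local_additive_cong:
  "local_additive T \<Longrightarrow> R \<ge> 0 \<Longrightarrow> (\<And>x. \<bar>x\<bar> > R \<Longrightarrow> f x = g x) \<Longrightarrow> \<bar>x\<bar> > R \<Longrightarrow> T f x = T g x"
  unfolding local_additive_def by metis

text \<open>Since 0 + 0 = 0, additivity gives T 0 = T 0 + T 0 off the origin, and one summand
  cancels.\<close>

lemma local_additive_zero:
  assumes "local_additive T" "x \<noteq> 0" shows "T (\<lambda>x. 0) x = 0"
  using local_additive_add[OF assms(1) smooth_off_0_const[of 0] smooth_off_0_const[of 0] assms(2)]
  by simp

lemma local_additive_vanishes:
  assumes "local_additive T" "R \<ge> 0" "\<And>x. \<bar>x\<bar> > R \<Longrightarrow> f x = 0" "\<bar>x\<bar> > R"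
  shows "T f x = 0"
proof -
  have "T f x = T (\<lambda>x. 0) x"
    by (rule local_additive_cong[OF assms(1,2) _ assms(4)]) (simp add: assms(3))
  then show ?thesis using local_additive_zero[OF assms(1), of x] assms(2,4) by auto
qed

lemma local_additive_id: "local_additive (\<lambda>f. f)"
  by (simp add: local_additive_def)

lemma local_additive_comp:
  assumes T: "local_additive T" and U: "local_additive U"
  shows "local_additive (\<lambda>f. T (U f))"
  unfolding local_additive_def
proof (intro conjI allI impI)
  fix f g :: "real \<Rightarrow> complex" and x :: real
  assume fg: "smooth_off_0 f" "smooth_off_0 g" and x: "x \<noteq> 0"
  \<comment> \<open>Additivity of U holds only off the origin, so the two arguments of T may differ
    at 0. Locality of T with R = 0 makes this harmless.\<close>
  have "T (U (\<lambda>x. f x + g x)) x = T (\<lambda>x. U f x + U g x) x"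
    by (rule local_additive_cong[OF T order_refl]) (use x local_additive_add[OF U fg] in auto)
  also have "\<dots> = T (U f) x + T (U g) x"
    by (rule local_additive_add[OF T local_additive_smooth[OF U fg(1)]
          local_additive_smooth[OF U fg(2)] x])
  finally show "T (U (\<lambda>x. f x + g x)) x = T (U f) x + T (U g) x" .
next
  fix R x :: real and f g :: "real \<Rightarrow> complex"
  assume "0 \<le> R" "\<forall>x. R < \<bar>x\<bar> \<longrightarrow> f x = g x" "R < \<bar>x\<bar>"
  then show "T (U f) x = T (U g) x"
    by (intro local_additive_cong[OF T] local_additive_cong[OF U]) auto
qed (use T U in \<open>blast intro: local_additive_smooth\<close>)

lemma local_additive_funpow:
  assumes "local_additive T" shows "local_additive (T ^^ m)"
proof (induction m)
  case 0
  show ?case using local_additive_id by (simp add: id_def)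
next
  case (Suc m)
  from local_additive_comp[OF assms this] show ?case by (simp add: o_def)
qed

section \<open>The differential operators as local additive operators\<close>

lemma local_additive_vderiv: "local_additive vderiv"
  unfolding local_additive_def
proof (intro conjI allI impI)
  fix f g :: "real \<Rightarrow> complex" and x :: real
  assume "smooth_off_0 f" "smooth_off_0 g" "x \<noteq> 0"
  then show "vderiv (\<lambda>x. f x + g x) x = vderiv f x + vderiv g x"
    by (intro vderivI has_vector_derivative_add has_vderiv smooth_off_0_differentiable)
next
  fix R x :: real and f g :: "real \<Rightarrow> complex"
  assume "0 \<le> R" "\<forall>x. R < \<bar>x\<bar> \<longrightarrow> f x = g x" "R < \<bar>x\<bar>"
  moreover have "open {x::real. R < \<bar>x\<bar>}"
    by (intro open_Collect_less continuous_intros)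
  ultimately show "vderiv f x = vderiv g x"
    by (intro vderiv_cong_open[of "{x. R < \<bar>x\<bar>}"]) auto
qed (rule smooth_off_0_vderiv)

lemma smooth_off_0_weighted_dunkl:
  assumes f: "smooth_off_0 f"
  shows "smooth_off_0 (weighted_dunkl k n f)"
proof -
  have f': "smooth_off_0 (vderiv f)" "smooth_off_0 ((vderiv ^^ 2) f)"
    using f by (auto intro: smooth_off_0_vderiv local_additive_smooth[OF
        local_additive_funpow[OF local_additive_vderiv]])
  \<comment> \<open>The coefficients 2k/x and k/x^2 are rewritten through the sign and powers of
    |x|, for which closure is known; the two forms agree off the origin.\<close>
  have "smooth_off_0 (\<lambda>x. (1 * \<bar>x\<bar> powr (2 - 2 / real n)) *\<^sub>R
      ((vderiv ^^ 2) f x + sgn x *\<^sub>R ((2 * k * \<bar>x\<bar> powr (- 1)) *\<^sub>R vderiv f x)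
        - (k * \<bar>x\<bar> powr (- 2)) *\<^sub>R (f x - f (- x))))"
    by (intro smooth_off_0_abs_powr_scale smooth_off_0_diff smooth_off_0_add
        smooth_off_0_sgn_scale smooth_off_0_reflect f f')
  then show ?thesis
  proof (rule smooth_off_0_cong)
    fix x :: real assume x: "x \<noteq> 0"
    have "sgn x * (2 * k * \<bar>x\<bar> powr (- 1)) = 2 * k / x"
      using x by (auto simp: powr_minus_divide sgn_if)
    moreover have "k * \<bar>x\<bar> powr (- 2) = k / x\<^sup>2"
      using x by (simp add: powr_minus_divide)
    ultimately show "(1 * \<bar>x\<bar> powr (2 - 2 / real n)) *\<^sub>R
      ((vderiv ^^ 2) f x + sgn x *\<^sub>R ((2 * k * \<bar>x\<bar> powr (- 1)) *\<^sub>R vderiv f x)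
        - (k * \<bar>x\<bar> powr (- 2)) *\<^sub>R (f x - f (- x))) = weighted_dunkl k n f x"
      unfolding weighted_dunkl_def dunkl_laplacian_def
      by (simp only: scaleR_scaleR mult_1)
  qed
qed

lemma local_additive_weighted_dunkl: "local_additive (weighted_dunkl k n)"
  unfolding local_additive_def
proof (intro conjI allI impI)
  fix f g :: "real \<Rightarrow> complex" and x :: real
  assume "smooth_off_0 f" "smooth_off_0 g" "x \<noteq> 0"
  then have "vderiv (\<lambda>x. f x + g x) x = vderiv f x + vderiv g x"
    "(vderiv ^^ 2) (\<lambda>x. f x + g x) x = (vderiv ^^ 2) f x + (vderiv ^^ 2) g x"
    by (rule local_additive_add[OF local_additive_vderiv]
        local_additive_add[OF local_additive_funpow[OF local_additive_vderiv]]; assumption)+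
  then show "weighted_dunkl k n (\<lambda>x. f x + g x) x =
      weighted_dunkl k n f x + weighted_dunkl k n g x"
    by (simp add: weighted_dunkl_def dunkl_laplacian_def algebra_simps)
next
  fix R x :: real and f g :: "real \<Rightarrow> complex"
  assume R: "0 \<le> R" and eq: "\<forall>x. R < \<bar>x\<bar> \<longrightarrow> f x = g x" and x: "R < \<bar>x\<bar>"
  have "T f x = T g x" if "local_additive T" for T
    using local_additive_cong[OF that R, of f g x] eq x by simp
  \<comment> \<open>The hypothesis \<open>eq\<close> serves at x and, because |-x| = |x|, also at -x
    for the reflected term.\<close>
  from this[OF local_additive_vderiv] this[OF local_additive_funpow[OF local_additive_vderiv]]
  show "weighted_dunkl k n f x = weighted_dunkl k n g x"
    using eq x by (simp add: weighted_dunkl_def dunkl_laplacian_def)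
qed (rule smooth_off_0_weighted_dunkl)

lemma local_additive_scaled:
  assumes "local_additive T" shows "local_additive (\<lambda>f x. c *\<^sub>R T f x)"
proof -
  have "local_additive (\<lambda>f x. c *\<^sub>R f x)"
    unfolding local_additive_def by (auto simp: scaleR_add_right intro: smooth_off_0_scaleR)
  from local_additive_comp[OF this assms] show ?thesis .
qed

lemma local_additive_euler_deriv: "local_additive (euler_deriv l)"
proof -
  have "local_additive (\<lambda>f x. x ^ l *\<^sub>R f x)"
    unfolding local_additive_def
    by (auto simp: scaleR_add_right intro: smooth_off_0_power_scale)
  from local_additive_comp[OF this local_additive_funpow[OF local_additive_vderiv, of l]]
  show ?thesis unfolding euler_deriv_def[abs_def] .
qed

section \<open>Seminorms and their topologies\<close>

text \<open>Needed so that every centre lies in its own semiball. The composed operator is additive,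
  so it sends 0 to 0 off the origin, where the supremum is taken.\<close>

lemma schwartz_seminorm_zero: "schwartz_seminorm k n i (\<lambda>x. 0) = 0"
proof -
  obtain \<alpha> \<beta> l where i: "i = (\<alpha>, \<beta>, l)" by (metis surj_pair)
  have "local_additive
      (\<lambda>f. ((\<lambda>h x. real n *\<^sub>R weighted_dunkl k n h x) ^^ \<beta>) (euler_deriv l f))"
    by (intro local_additive_funpow local_additive_scaled local_additive_weighted_dunkl
        local_additive_comp[OF _ local_additive_euler_deriv])
  from local_additive_zero[OF this] show ?thesis
    unfolding i schwartz_seminorm_def P_seminorm_def split_conv
    by (intro antisym SUP_least) auto
qed

text \<open>The composed operator is additive at each nonzero x, so the norm inequality holds
  pointwise, and each summand is below its own supremum. Working in \<open>ennreal\<close> allows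
  infinite values.\<close>

lemma schwartz_seminorm_triangle:
  assumes "smooth_off_0 f" "smooth_off_0 g"
  shows "schwartz_seminorm k n i (\<lambda>x. f x + g x)
    \<le> schwartz_seminorm k n i f + schwartz_seminorm k n i g"
proof -
  obtain \<alpha> \<beta> l where i: "i = (\<alpha>, \<beta>, l)" by (metis surj_pair)
  define T where
    "T f = ((\<lambda>h x. real n *\<^sub>R weighted_dunkl k n h x) ^^ \<beta>) (euler_deriv l f)" for f
  define w where "w x = (real n * \<bar>x\<bar> powr (2 / real n)) ^ \<alpha>" for x :: real
  have T: "local_additive T"
    unfolding T_def by (intro local_additive_funpow local_additive_scaled local_additive_weighted_dunkl
        local_additive_comp[OF _ local_additive_euler_deriv])
  have p: "schwartz_seminorm k n i h = (SUP x\<in>-{0}. ennreal (norm (w x *\<^sub>R T h x)))" for h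
    by (simp add: i schwartz_seminorm_def P_seminorm_def T_def w_def)
  show ?thesis unfolding p
  proof (rule SUP_least)
    fix x :: real assume x: "x \<in> -{0}"
    have "norm (w x *\<^sub>R T (\<lambda>x. f x + g x) x) \<le> norm (w x *\<^sub>R T f x) + norm (w x *\<^sub>R T g x)"
      using local_additive_add[OF T assms, of x] x by (simp add: scaleR_add_right norm_triangle_ineq
          del: norm_scaleR)
    then have "ennreal (norm (w x *\<^sub>R T (\<lambda>x. f x + g x) x))
        \<le> ennreal (norm (w x *\<^sub>R T f x)) + ennreal (norm (w x *\<^sub>R T g x))"
      by (simp add: ennreal_leI del: norm_scaleR flip: ennreal_plus)
    also have "\<dots> \<le> (SUP x\<in>-{0}. ennreal (norm (w x *\<^sub>R T f x)))
        + (SUP x\<in>-{0}. ennreal (norm (w x *\<^sub>R T g x)))"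
      using x by (intro add_mono SUP_upper)
    finally show "ennreal (norm (w x *\<^sub>R T (\<lambda>x. f x + g x) x))
      \<le> (SUP x\<in>-{0}. ennreal (norm (w x *\<^sub>R T f x)))
        + (SUP x\<in>-{0}. ennreal (norm (w x *\<^sub>R T g x)))" .
  qed
qed

text \<open>The trace on V of a semiball of W need not be a generator, so its openness is checked
  pointwise: each g in it is the centre of a smaller semiball of V inside it. The three-point form
  of \<open>triangle\<close> avoids asking that differences lie in W.\<close>

lemma continuous_map_seminorm_topology_subset:
  assumes VW: "V \<subseteq> W" and zero: "\<And>i. p i (\<lambda>x. 0) = 0"
    and triangle: "\<And>i f g h. f \<in> W \<Longrightarrow> g \<in> W \<Longrightarrow> h \<in> W \<Longrightarrow>
      p i (\<lambda>x. f x - h x) \<le> p i (\<lambda>x. f x - g x) + p i (\<lambda>x. g x - h x)"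
  shows "continuous_map (seminorm_topology V p) (seminorm_topology W p) (\<lambda>f. f)"
proof -
  let ?D = "seminorm_topology V p"
  have ball: "openin ?D {g \<in> V. p i (\<lambda>x. g x - f x) < ennreal \<epsilon>}" if "f \<in> V" "0 < \<epsilon>" for i f \<epsilon>
    unfolding seminorm_topology_def using that by (intro topology_generated_by_Basis) blast
  \<comment> \<open>The underlying set of a generated topology is the union of its generators; in
    particular it lies in V.\<close>
  have top: "topspace ?D = \<Union>{{g \<in> V. p i (\<lambda>x. g x - f x) < ennreal \<epsilon>} | i f \<epsilon>. f \<in> V \<and> 0 < \<epsilon>}"
    by (simp add: seminorm_topology_def)
  show ?thesis
    unfolding seminorm_topology_def[of W p] continuous_on_generated_topo_iff
  proof (intro conjI allI impI)
    show "(\<lambda>f. f) ` topspace ?D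
        \<subseteq> \<Union>{{g \<in> W. p i (\<lambda>x. g x - f x) < ennreal \<epsilon>} | i f \<epsilon>. f \<in> W \<and> 0 < \<epsilon>}"
      unfolding top using VW by blast
  next
    fix U assume "U \<in> {{g \<in> W. p i (\<lambda>x. g x - f x) < ennreal \<epsilon>} | i f \<epsilon>. f \<in> W \<and> 0 < \<epsilon>}"
    then obtain i f \<epsilon> where f: "f \<in> W" "0 < \<epsilon>"
      and U: "U = {g \<in> W. p i (\<lambda>x. g x - f x) < ennreal \<epsilon>}" by blast
    show "openin ?D ((\<lambda>f. f) -` U \<inter> topspace ?D)"
    proof (subst openin_subopen, intro ballI)
      fix g assume g: "g \<in> (\<lambda>f. f) -` U \<inter> topspace ?D"
      then have gV: "g \<in> V" and lt: "p i (\<lambda>x. g x - f x) < ennreal \<epsilon>"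
        by (auto simp: top U)
      \<comment> \<open>A value below \<epsilon> is finite, so the distance from g to the centre f
        is a real number r and the radius \<epsilon> - r makes sense.\<close>
      define r where "r = enn2real (p i (\<lambda>x. g x - f x))"
      have r: "p i (\<lambda>x. g x - f x) = ennreal r" "r \<ge> 0"
        using lt by (auto simp: r_def less_top[symmetric] dest: order.strict_trans2[OF _ top_greatest])
      have re: "r < \<epsilon>" using lt r by (simp add: ennreal_less_iff)
      let ?B = "{h \<in> V. p i (\<lambda>x. h x - g x) < ennreal (\<epsilon> - r)}"
      have open_B: "openin ?D ?B" using ball[OF gV, of "\<epsilon> - r" i] re by simp
      moreover have "g \<in> ?B" using gV re zero by simp
      moreover have "?B \<subseteq> (\<lambda>f. f) -` U \<inter> topspace ?D"
      proof
        fix h assume h: "h \<in> ?B"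
        have "p i (\<lambda>x. h x - f x) \<le> p i (\<lambda>x. h x - g x) + p i (\<lambda>x. g x - f x)"
          using triangle h gV f VW by blast
        \<comment> \<open>The strict inequality survives adding r because r is finite.\<close>
        also have "\<dots> < ennreal (\<epsilon> - r) + ennreal r"
          using h r by (simp add: add.commute[of _ "ennreal r"] ennreal_add_left_cancel_less)
        also have "\<dots> = ennreal \<epsilon>" using r re by (simp flip: ennreal_plus)
        finally show "h \<in> (\<lambda>f. f) -` U \<inter> topspace ?D"
          using h VW openin_subset[OF open_B] by (auto simp: U)
      qed
      ultimately show "\<exists>T. openin ?D T \<and> g \<in> T \<and> T \<subseteq> (\<lambda>f. f) -` U \<inter> topspace ?D" by blast
    qed
  qed
qed

section \<open>Inclusion of the spaces and continuity of the embedding\<close>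

lemma D_space_subset_S_space: "D_space k n \<subseteq> S_space k n"
proof
  fix f assume f: "f \<in> D_space k n"
  then have "bounded {x. f x \<noteq> 0}" by (simp add: D_space_def)
  then obtain R where R: "R > 0" "\<And>x. f x \<noteq> 0 \<Longrightarrow> \<bar>x\<bar> \<le> R"
    by (auto simp: bounded_pos)
  have "(SUP x\<in>-{0}. ennreal (norm ((\<bar>x\<bar> powr (2 / real n)) ^ \<alpha> *\<^sub>R
      (weighted_dunkl k n ^^ \<beta>) (euler_deriv l f) x))) < \<infinity>" for \<alpha> \<beta> l
  proof -
    define T where "T f = (weighted_dunkl k n ^^ \<beta>) (euler_deriv l f)" for f
    have T: "local_additive T"
      unfolding T_def by (intro local_additive_funpow local_additive_weighted_dunkl
          local_additive_comp[OF _ local_additive_euler_deriv])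
    \<comment> \<open>The weight at the end of the interval |x| \<le> R, hence its largest value
      there.\<close>
    let ?C = "(R powr (2 / real n)) ^ \<alpha>"
    have "(SUP x\<in>-{0}. ennreal (norm ((\<bar>x\<bar> powr (2 / real n)) ^ \<alpha> *\<^sub>R T f x)))
        \<le> ennreal ?C * (SUP x\<in>-{0}. ennreal (norm (T f x)))"
    proof (rule SUP_least)
      fix x :: real assume x: "x \<in> -{0}"
      have "norm ((\<bar>x\<bar> powr (2 / real n)) ^ \<alpha> *\<^sub>R T f x) \<le> ?C * norm (T f x)"
      \<comment> \<open>Inside the interval the weight is monotone in |x|; outside it f vanishes, so
        T f does too.\<close>
      proof (cases "\<bar>x\<bar> \<le> R")
        case True
        then show ?thesis
          by (auto intro!: mult_right_mono power_mono powr_mono2 simp: power_abs[symmetric])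
      next
        case False
        then have "T f x = 0"
          using R by (intro local_additive_vanishes[OF T, of R]) (auto simp: not_le[symmetric])
        then show ?thesis by simp
      qed
      then have "ennreal (norm ((\<bar>x\<bar> powr (2 / real n)) ^ \<alpha> *\<^sub>R T f x))
          \<le> ennreal ?C * ennreal (norm (T f x))"
        by (simp add: ennreal_leI flip: ennreal_mult)
      also have "\<dots> \<le> ennreal ?C * (SUP x\<in>-{0}. ennreal (norm (T f x)))"
        using x by (intro mult_left_mono SUP_upper) auto
      finally show "ennreal (norm ((\<bar>x\<bar> powr (2 / real n)) ^ \<alpha> *\<^sub>R T f x))
        \<le> ennreal ?C * (SUP x\<in>-{0}. ennreal (norm (T f x)))" .
    qed
    \<comment> \<open>The remaining supremum carries no weight and is finite by the definition of
      \<open>D_space\<close>.\<close>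
    also have "\<dots> < \<infinity>"
      using f by (simp add: D_space_def T_def ennreal_mult_less_top)
    finally show ?thesis by (simp add: T_def)
  qed
  then show "f \<in> S_space k n" using f by (simp add: S_space_def D_space_def)
qed

theorem theorem2p2:
  fixes n :: nat and k :: real
  assumes "n \<ge> 1"
  shows "D_space k n \<subseteq> S_space k n \<and>
         continuous_map (D_topology k n) (S_topology k n) (\<lambda>f. f)"
proof
  show "continuous_map (D_topology k n) (S_topology k n) (\<lambda>f. f)"
    unfolding D_topology_def S_topology_def
  proof (rule continuous_map_seminorm_topology_subset)
    fix i and f g h :: "real \<Rightarrow> complex"
    assume "f \<in> S_space k n" "g \<in> S_space k n" "h \<in> S_space k n"
    then have "smooth_off_0 f" "smooth_off_0 g" "smooth_off_0 h"
      by (auto simp: S_space_def smooth_punctured_def smooth_off_0_def)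
    \<comment> \<open>Both differences are smooth off 0, and their sum telescopes to f - h.\<close>
    then show "schwartz_seminorm k n i (\<lambda>x. f x - h x)
        \<le> schwartz_seminorm k n i (\<lambda>x. f x - g x) + schwartz_seminorm k n i (\<lambda>x. g x - h x)"
      using schwartz_seminorm_triangle[of "\<lambda>x. f x - g x" "\<lambda>x. g x - h x" k n i]
      by (simp add: smooth_off_0_diff)
  qed (rule D_space_subset_S_space schwartz_seminorm_zero)+
qed (rule D_space_subset_S_space)

end
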